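(* Let $H$ be a finite group with neutral element $e$, $X$ and $Y$ topological spaces, and let $(h,x)\mapsto hx$ be a free left action of $H$ on $X$. Let $F\colon X\to F_H(Y)$ be a map that is equivariant in the sense that $F(hx)=\iota(h)\star F(x)$ for all $h\in H$, $x\in X$, and let $f\colon X\to Y$ be the map given by $f(x)=F(x)(e)$. Then for arbitrary $h\in H$ and $x\in X$ we have $f(hx)=F(x)(h)$. In particular, $f$ is injective when restricted to any $H$-orbit in $X$ and, in fact, $F=F_f$.
   Context: $F_H(Y)$ is the space of injective maps $H\to Y$ with the compact-open topology ($H$ discrete). $S_H$ is the group of bijections of the set $H$ with product $\alpha_1\alpha_2:=\alpha_2\circ\alpha_1$; it acts on the left on $F_H(Y)$ by $\alpha\star\beta=\beta\circ\alpha$. The monomorphism $\iota\colon H\to S_H$ is given by $\iota(h)(h_1)=h_1h$. For a map $f\colon X\to Y$ injective on every $H$-orbit, $F_f\colon X\to F_H(Y)$ denotes the map $F_f(x)(h)=f(hx)$. "Map" means continuous map. *)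

theory Defs
  imports "HOL-Analysis.Analysis" "HOL-Algebra.Group_Action"
begin

text \<open>Points of a mapping space are continuous maps, represented extensionally (value
  \<^term>\<open>undefined\<close> off the domain) so that equality of functions is equality of maps. The subbasic
  set for \<^term>\<open>K = {}\<close> is the set of all these maps, which is therefore the carrier.\<close>

definition compact_open_topology :: "'a topology \<Rightarrow> 'b topology \<Rightarrow> ('a \<Rightarrow> 'b) topology" where
  "compact_open_topology A B =
     topology_generated_by
       {{g \<in> extensional (topspace A). continuous_map A B g \<and> g ` K \<subseteq> U} | K U.
          compactin A K \<and> openin B U}"

definition inj_map_space :: "'h set \<Rightarrow> 'y topology \<Rightarrow> ('h \<Rightarrow> 'y) topology" where
  "inj_map_space S Y =
     subtopology (compact_open_topology (discrete_topology S) Y) {g. inj_on g S}"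

text \<open>The symmetric group of a set with the product \<open>\<alpha>\<^sub>1 \<alpha>\<^sub>2 = \<alpha>\<^sub>2 \<circ> \<alpha>\<^sub>1\<close>, which is opposite to
  the library's \<^const>\<open>BijGroup\<close>.\<close>

definition sym_group_op :: "'h set \<Rightarrow> ('h \<Rightarrow> 'h) monoid" where
  "sym_group_op S =
     \<lparr>carrier = Bij S,
      mult = \<lambda>\<alpha>\<^sub>1\<in>Bij S. \<lambda>\<alpha>\<^sub>2\<in>Bij S. compose S \<alpha>\<^sub>2 \<alpha>\<^sub>1,
      one = \<lambda>h\<in>S. h\<rparr>"

definition star :: "'h set \<Rightarrow> ('h \<Rightarrow> 'h) \<Rightarrow> ('h \<Rightarrow> 'y) \<Rightarrow> ('h \<Rightarrow> 'y)" where
  "star S \<alpha> \<beta> = compose S \<beta> \<alpha>"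

definition iota :: "('h, 'm) monoid_scheme \<Rightarrow> 'h \<Rightarrow> ('h \<Rightarrow> 'h)" where
  "iota H h = (\<lambda>h\<^sub>1\<in>carrier H. h\<^sub>1 \<otimes>\<^bsub>H\<^esub> h)"

text \<open>The library's \<^locale>\<open>group_action\<close> is a homomorphism into \<^const>\<open>BijGroup\<close>, i.e. a left
  action.\<close>

definition free_continuous_action ::
    "('h, 'm) monoid_scheme \<Rightarrow> 'x topology \<Rightarrow> ('h \<Rightarrow> 'x \<Rightarrow> 'x) \<Rightarrow> bool" where
  "free_continuous_action H X \<phi> \<longleftrightarrow>
     group_action H (topspace X) \<phi> \<and>
     continuous_map (prod_topology (discrete_topology (carrier H)) X) X (\<lambda>(h, x). \<phi> h x) \<and>
     (\<forall>h \<in> carrier H. \<forall>x \<in> topspace X. \<phi> h x = x \<longrightarrow> h = \<one>\<^bsub>H\<^esub>)"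

definition induced_map ::
    "('h, 'm) monoid_scheme \<Rightarrow> ('h \<Rightarrow> 'x \<Rightarrow> 'x) \<Rightarrow> ('x \<Rightarrow> 'y) \<Rightarrow> 'x \<Rightarrow> ('h \<Rightarrow> 'y)" where
  "induced_map H \<phi> f x = (\<lambda>h\<in>carrier H. f (\<phi> h x))"

lemma topspace_inj_map_space:
  "topspace (inj_map_space S Y) = {g \<in> S \<rightarrow>\<^sub>E topspace Y. inj_on g S}"
proof -
  have "topspace (compact_open_topology (discrete_topology S) Y) = S \<rightarrow>\<^sub>E topspace Y"
    unfolding compact_open_topology_def topology_generated_by_topspace
  proof (intro equalityI subsetI)
    fix g assume "g \<in> S \<rightarrow>\<^sub>E topspace Y"
    then have "g \<in> {g \<in> extensional (topspace (discrete_topology S)).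
        continuous_map (discrete_topology S) Y g \<and> g ` {} \<subseteq> {}}"
      by (auto simp: PiE_def)
    then show "g \<in> \<Union> {{g \<in> extensional (topspace (discrete_topology S)).
        continuous_map (discrete_topology S) Y g \<and> g ` K \<subseteq> U} | K U.
          compactin (discrete_topology S) K \<and> openin Y U}"
      using compactin_empty openin_empty by blast
  qed (auto simp: PiE_def)
  then show ?thesis
    by (auto simp: inj_map_space_def)
qed

lemma group_sym_group_op: "group (sym_group_op S)"
proof (rule groupI)
  fix \<alpha> assume a: "\<alpha> \<in> carrier (sym_group_op S)"
  then have "compose S \<alpha> (\<lambda>h\<in>S. inv_into S \<alpha> h) = (\<lambda>h\<in>S. h)"
    by (auto simp: sym_group_op_def Bij_def bij_betw_def compose_def f_inv_into_f
        intro!: restrict_ext)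
  with a show "\<exists>\<beta>\<in>carrier (sym_group_op S).
      \<beta> \<otimes>\<^bsub>sym_group_op S\<^esub> \<alpha> = \<one>\<^bsub>sym_group_op S\<^esub>"
    unfolding sym_group_op_def
    by (intro bexI [where x = "\<lambda>h\<in>S. inv_into S \<alpha> h"]) (simp_all add: restrict_inv_into_Bij)
next
  fix \<alpha> \<beta> \<gamma>
  assume "\<alpha> \<in> carrier (sym_group_op S)" "\<beta> \<in> carrier (sym_group_op S)" "\<gamma> \<in> carrier (sym_group_op S)"
  then show "\<alpha> \<otimes>\<^bsub>sym_group_op S\<^esub> \<beta> \<otimes>\<^bsub>sym_group_op S\<^esub> \<gamma> =
      \<alpha> \<otimes>\<^bsub>sym_group_op S\<^esub> (\<beta> \<otimes>\<^bsub>sym_group_op S\<^esub> \<gamma>)"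
    by (simp add: sym_group_op_def compose_Bij compose_assoc Bij_imp_funcset)
qed (auto simp: sym_group_op_def compose_Bij id_Bij Bij_imp_extensional
      intro!: compose_Id Bij_imp_funcset)

lemma iota_hom:
  assumes "group H"
  shows "iota H \<in> hom H (sym_group_op (carrier H))"
    and "inj_on (iota H) (carrier H)"
proof -
  interpret group H by fact
  have bij: "iota H h \<in> Bij (carrier H)" if "h \<in> carrier H" for h
    unfolding Bij_def iota_def
    using that by (auto intro!: bij_betwI [where g = "\<lambda>x. x \<otimes>\<^bsub>H\<^esub> inv\<^bsub>H\<^esub> h"] simp: m_assoc)
  then show "iota H \<in> hom H (sym_group_op (carrier H))"
    by (auto simp: hom_def sym_group_op_def) (auto simp: iota_def compose_def m_assoc fun_eq_iff)
  show "inj_on (iota H) (carrier H)"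
    by (rule inj_on_inverseI [where g = "\<lambda>\<alpha>. \<alpha> \<one>\<^bsub>H\<^esub>"]) (simp add: iota_def)
qed

end

theory Submission
  imports Defs
begin

text \<open>Everything comes from evaluating the equivariance of \<open>F\<close> at the neutral
  element e: f(hx) = F(hx)(e) = F(x)(iota(h)(e)) = F(x)(eh) = F(x)(h). Hence composing
  \<open>f\<close> with the orbit map h -> hx gives the injective map F(x), so \<open>f\<close> is
  injective on the orbit of x, and F(x) is by definition the map induced by \<open>f\<close>.
  Continuity of \<open>f\<close> holds because \<open>f\<close> is \<open>F\<close> followed by
  evaluation at e, which \<open>continuous_map_eval_inj_map_space\<close> shows to be
  continuous.\<close>

text \<open>Singletons are compact, so the preimage of an open \<open>U\<close> under evaluation at
  \<open>s\<close> is the trace on the injective maps of the subbasic set with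
  \<open>K = {s}\<close>.\<close>

lemma continuous_map_eval_inj_map_space:
  assumes "s \<in> S"
  shows "continuous_map (inj_map_space S Y) Y (\<lambda>g. g s)"
  unfolding continuous_map_def
proof (intro conjI allI impI)
  show "(\<lambda>g. g s) \<in> topspace (inj_map_space S Y) \<rightarrow> topspace Y"
    using assms by (auto simp: topspace_inj_map_space)
next
  fix U assume U: "openin Y U"
  let ?D = "discrete_topology S"
  let ?W = "{g \<in> extensional (topspace ?D). continuous_map ?D Y g \<and> g ` {s} \<subseteq> U}"
  have "openin (compact_open_topology ?D Y) ?W"
    unfolding compact_open_topology_def
  proof (rule topology_generated_by_Basis, intro CollectI exI conjI)
    show "compactin ?D {s}"
      using assms by (simp add: compactin_sing)
  qed (use U in simp_all)
  moreover have "{g \<in> topspace (inj_map_space S Y). g s \<in> U} = ?W \<inter> {g. inj_on g S}"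
    by (auto simp: topspace_inj_map_space PiE_def)
  ultimately show "openin (inj_map_space S Y) {g \<in> topspace (inj_map_space S Y). g s \<in> U}"
    by (auto simp: inj_map_space_def openin_subtopology)
qed

theorem lemma2p3:
  fixes H :: "('h, 'm) monoid_scheme"
    and X :: "'x topology"
    and Y :: "'y topology"
    and \<phi> :: "'h \<Rightarrow> 'x \<Rightarrow> 'x"
    and F :: "'x \<Rightarrow> 'h \<Rightarrow> 'y"
    and f :: "'x \<Rightarrow> 'y"
  assumes "group H"
    and "finite (carrier H)"
    and "free_continuous_action H X \<phi>"
    and "continuous_map X (inj_map_space (carrier H) Y) F"
    and "\<And>h x. \<lbrakk>h \<in> carrier H; x \<in> topspace X\<rbrakk> \<Longrightarrow>
           F (\<phi> h x) = star (carrier H) (iota H h) (F x)"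
    and "\<And>x. x \<in> topspace X \<Longrightarrow> f x = F x \<one>\<^bsub>H\<^esub>"
  shows "continuous_map X Y f \<and>
    (\<forall>h \<in> carrier H. \<forall>x \<in> topspace X. f (\<phi> h x) = F x h) \<and>
    (\<forall>B \<in> orbits H (topspace X) \<phi>. inj_on f B) \<and>
    (\<forall>x \<in> topspace X. F x = induced_map H \<phi> f x)"
proof -
  interpret group H by fact
  interpret action: group_action H "topspace X" \<phi>
    using assms(3) by (simp add: free_continuous_action_def)
  have F_mem: "F x \<in> carrier H \<rightarrow>\<^sub>E topspace Y" "inj_on (F x) (carrier H)" if "x \<in> topspace X" for x
    using continuous_map_image_subset_topspace[OF assms(4)] that
    by (auto simp: topspace_inj_map_space)
  have cont: "continuous_map X Y f"
  proof (rule continuous_map_eq)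
    show "continuous_map X Y ((\<lambda>g. g \<one>\<^bsub>H\<^esub>) \<circ> F)"
      using continuous_map_compose[OF assms(4) continuous_map_eval_inj_map_space] by simp
  qed (simp add: assms(6))
  have f_act: "f (\<phi> h x) = F x h" if "h \<in> carrier H" "x \<in> topspace X" for h x
    \<comment> \<open>The action keeps \<open>\<phi> h x\<close> in the space, so the formula
      defining \<open>f\<close> applies at that point too.\<close>
    using that action.element_image[of h x]
    by (simp add: assms(5,6) star_def iota_def compose_def)
  have inj: "inj_on f B" if B: "B \<in> orbits H (topspace X) \<phi>" for B
  proof -
    obtain x where x: "x \<in> topspace X" and B_eq: "B = (\<lambda>h. \<phi> h x) ` carrier H"
      using B by (auto simp: orbits_def orbit_def)
    \<comment> \<open>On \<open>carrier H\<close> this composite agrees with \<open>F x\<close>; its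
      injectivity then passes to \<open>f\<close> on the image of the orbit map.\<close>
    have "inj_on (f \<circ> (\<lambda>h. \<phi> h x)) (carrier H)"
      using F_mem(2)[OF x] by (rule inj_on_cong[THEN iffD1, rotated]) (simp add: f_act x)
    then show ?thesis
      unfolding B_eq by (rule inj_on_imageI)
  qed
  \<comment> \<open>Outside \<open>carrier H\<close> both sides take the value
    \<open>undefined\<close>, so agreement on \<open>carrier H\<close> gives equality of
    functions.\<close>
  have "F x = induced_map H \<phi> f x" if "x \<in> topspace X" for x
    using F_mem(1)[OF that] that by (auto simp: induced_map_def f_act PiE_def extensional_def)
  with cont f_act inj show ?thesis
    by blast
qed

end
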